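(* Let $\varepsilon>0$. There exists $\delta>0$ such that for any estimator $\tilde d=\tilde d(X)$, any $\tau>0$ and any $L\in\mathbb{N}$, $$\sup_{\theta\in\ell_2}\mathrm{P}_\theta\big(|\tilde d-d_\tau(\theta)|\ge L\big)\ge\delta.$$
   Context: $\mathbb{N}=\{1,2,\ldots\}$; $\ell_2$ is the space of square-summable real sequences $\theta=(\theta_i)_{i\in\mathbb{N}}$. The noise level $\varepsilon>0$ is fixed and known. Model: the data are $X=(X_i)_{i\in\mathbb{N}}$ with independent $X_i\sim \mathrm{N}(\theta_i,\varepsilon^2)$, where $\theta\in\ell_2$; $\mathrm{P}_\theta$ denotes the law of $X$. Local effective $\tau$-dimension: for $\tau>0$ and $\theta\in\ell_2$, $d_\tau(\theta)\in\mathbb{N}$ is a minimizer over $d\in\mathbb{N}$ of $r_\tau(d,\theta)=\sum_{i>d}\theta_i^2+\tau d\varepsilon^2$ (if there are several minimizers, any fixed choice). An estimator is a (real-valued, in particular possibly $\mathbb{N}$-valued) measurable function of $X$ that does not depend on $\theta$. *)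

theory Defs
  imports "HOL-Probability.Probability"
begin

text \<open>
  The paper's index set of positive integers is \<open>{1..} :: nat set\<close>. Sequences are
  extensional functions on it, so that parameters and observations carry no value at index 0.
\<close>

definition ell2 :: "(nat \<Rightarrow> real) set" where
  "ell2 = {\<theta> \<in> extensional {1..}. (\<lambda>i. (\<theta> i)\<^sup>2) summable_on {1..}}"

definition gauss_seq :: "real \<Rightarrow> (nat \<Rightarrow> real) \<Rightarrow> (nat \<Rightarrow> real) measure" where
  "gauss_seq \<epsilon> \<theta> = (\<Pi>\<^sub>M i\<in>{1..}. density lborel (normal_density (\<theta> i) \<epsilon>))"

definition estimators :: "((nat \<Rightarrow> real) \<Rightarrow> real) set" where
  "estimators = borel_measurable (\<Pi>\<^sub>M i\<in>{1..}. borel)"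

definition risk_proxy :: "real \<Rightarrow> real \<Rightarrow> (nat \<Rightarrow> real) \<Rightarrow> nat \<Rightarrow> real" where
  "risk_proxy \<epsilon> \<tau> \<theta> d = (\<Sum>\<^sub>\<infinity>i\<in>{d<..}. (\<theta> i)\<^sup>2) + \<tau> * real d * \<epsilon>\<^sup>2"

text \<open>
  Minimizers of the risk proxy need not be unique: \<open>d\<close> is any function picking one of them
  for each \<open>\<tau>\<close> and \<open>\<theta>\<close>.
\<close>

definition effective_dimension :: "real \<Rightarrow> (real \<Rightarrow> (nat \<Rightarrow> real) \<Rightarrow> nat) \<Rightarrow> bool" where
  "effective_dimension \<epsilon> d \<longleftrightarrow>
     (\<forall>\<tau>>0. \<forall>\<theta>\<in>ell2. is_arg_min (risk_proxy \<epsilon> \<tau> \<theta>) (\<lambda>k. k \<ge> 1) (d \<tau> \<theta>))"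

end

theory Submission
  imports Defs
begin

text \<open>
  Take \<open>\<theta>\<close> with a single nonzero coordinate, at index \<open>m = 2L + 1\<close>. The minimizer of the risk
  proxy is then \<open>m\<close> or \<open>1\<close> according to whether \<open>(\<theta> m)\<^sup>2\<close> lies above or below the threshold
  \<open>2L\<tau>\<epsilon>\<^sup>2\<close>. Two values of \<open>\<theta> m\<close> on either side of the threshold can be at most \<open>\<epsilon>\<close> apart,
  so the two laws share a component of fixed mass while the effective dimensions differ by \<open>2L\<close>.
\<close>

text \<open>The product measure is the image of the product of \<open>M i\<close> and
  \<open>PiM (I - {i}) M\<close> under \<open>(x, X) \<mapsto> X(i := x)\<close>, so Tonelli's
  section formula applies to the preimage of \<open>A\<close>. The index set may be infinite, and
  isolating one factor makes its density accessible.\<close>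

lemma emeasure_PiM_coordinate:
  assumes M: "\<And>j. j \<in> I \<Longrightarrow> prob_space (M j)" and i: "i \<in> I" and A: "A \<in> sets (PiM I M)"
  shows "emeasure (PiM I M) A =
    (\<integral>\<^sup>+x. emeasure (PiM (I - {i}) M) {X \<in> space (PiM (I - {i}) M). X(i := x) \<in> A} \<partial>M i)"
    and "(\<lambda>x. emeasure (PiM (I - {i}) M) {X \<in> space (PiM (I - {i}) M). X(i := x) \<in> A})
      \<in> borel_measurable (M i)"
    and "\<And>x. x \<in> space (M i) \<Longrightarrow>
      {X \<in> space (PiM (I - {i}) M). X(i := x) \<in> A} \<in> sets (PiM (I - {i}) M)"
proof -
  let ?R = "PiM (I - {i}) M"
  let ?h = "\<lambda>(x, X). X(i := x)"
  have ins: "insert i (I - {i}) = I" using i by auto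
  interpret R: prob_space ?R using M by (intro prob_space_PiM) auto
  have eq: "distr (M i \<Otimes>\<^sub>M ?R) (PiM I M) ?h = PiM I M"
    using distr_pair_PiM_eq_PiM[of "I - {i}" M i] M i unfolding ins by auto
  have h: "?h \<in> measurable (M i \<Otimes>\<^sub>M ?R) (PiM I M)"
    using measurable_comp[OF measurable_pair_swap' measurable_add_dim[of i "I - {i}" M]]
    unfolding ins by (simp add: comp_def split_beta')
  define S where "S = ?h -` A \<inter> space (M i \<Otimes>\<^sub>M ?R)"
  have S: "S \<in> sets (M i \<Otimes>\<^sub>M ?R)" unfolding S_def using h A by (rule measurable_sets)
  have sec: "Pair x -` S = {X \<in> space ?R. X(i := x) \<in> A}" if "x \<in> space (M i)" for x
    using that by (auto simp: S_def space_pair_measure)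
  have "emeasure (PiM I M) A = emeasure (M i \<Otimes>\<^sub>M ?R) S"
    unfolding S_def by (subst eq[symmetric]) (simp add: emeasure_distr[OF h A])
  also have "\<dots> = (\<integral>\<^sup>+x. emeasure ?R (Pair x -` S) \<partial>M i)"
    by (rule R.emeasure_pair_measure_alt[OF S])
  also have "\<dots> = (\<integral>\<^sup>+x. emeasure ?R {X \<in> space ?R. X(i := x) \<in> A} \<partial>M i)"
    by (intro nn_integral_cong) (simp add: sec)
  finally show "emeasure (PiM I M) A =
    (\<integral>\<^sup>+x. emeasure ?R {X \<in> space ?R. X(i := x) \<in> A} \<partial>M i)" .
  show "(\<lambda>x. emeasure ?R {X \<in> space ?R. X(i := x) \<in> A}) \<in> borel_measurable (M i)"
    using R.measurable_emeasure_Pair[OF S] by (rule measurable_cong[THEN iffD1, rotated]) (simp add: sec)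
  show "{X \<in> space ?R. X(i := x) \<in> A} \<in> sets ?R" if "x \<in> space (M i)" for x
    using sets_Pair1[OF S, of x] sec[OF that] by simp
qed

lemma prob_space_gauss_seq: "\<epsilon> > 0 \<Longrightarrow> prob_space (gauss_seq \<epsilon> \<theta>)"
  unfolding gauss_seq_def by (intro prob_space_PiM prob_space_normal_density)

lemma sets_gauss_seq: "sets (gauss_seq \<epsilon> \<theta>) = sets (\<Pi>\<^sub>M i\<in>{1..}. borel)"
  unfolding gauss_seq_def by (intro sets_PiM_cong) auto

text \<open>Within one standard deviation of the mean the exponent is at least -1/2; the bound is
  the value of the density at distance exactly \<open>\<sigma>\<close>.\<close>

lemma normal_density_lower_bound:
  assumes "\<sigma> > 0" and "\<bar>x - \<mu>\<bar> \<le> \<sigma>"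
  shows "exp (- 1 / 2) / (sqrt (2 * pi) * \<sigma>) \<le> normal_density \<mu> \<sigma> x"
proof -
  have "(x - \<mu>)\<^sup>2 \<le> \<sigma>\<^sup>2"
    using power_mono[OF assms(2), of 2] by simp
  then have "(x - \<mu>)\<^sup>2 / (2 * \<sigma>\<^sup>2) \<le> 1 / 2"
    using assms(1) by (simp add: divide_simps)
  then have "exp (- 1 / 2) \<le> exp (- (x - \<mu>)\<^sup>2 / (2 * \<sigma>\<^sup>2))"
    by simp
  moreover have "sqrt (2 * pi * \<sigma>\<^sup>2) = sqrt (2 * pi) * \<sigma>"
    using assms(1) by (simp add: real_sqrt_mult)
  ultimately show ?thesis
    using assms(1) unfolding normal_density_def by (simp add: divide_simps)
qed

text \<open>Le Cam's two-point argument: both laws dominate one common measure, namely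
  \<open>c\<close> times Lebesgue measure on \<open>J\<close> in coordinate \<open>m\<close> and
  \<open>R\<close> in the others. Since \<open>A\<close> and \<open>B\<close> cover the sample
  space, their masses under it already add up to at least its total mass.\<close>

lemma gauss_seq_overlap:
  assumes "\<epsilon> > 0" and "m \<ge> 1"
    and agree: "\<And>i. i \<ge> 1 \<Longrightarrow> i \<noteq> m \<Longrightarrow> \<theta> i = \<theta>' i"
    and near: "\<bar>\<theta> m - s\<bar> \<le> \<epsilon> / 2" "\<bar>\<theta>' m - s\<bar> \<le> \<epsilon> / 2"
    and A: "A \<in> sets (\<Pi>\<^sub>M i\<in>{1..}. borel)" and B: "B \<in> sets (\<Pi>\<^sub>M i\<in>{1..}. borel)"
    and cover: "space (\<Pi>\<^sub>M i\<in>{1..}. borel) \<subseteq> A \<union> B"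
  shows "exp (- 1 / 2) / sqrt (2 * pi)
    \<le> measure (gauss_seq \<epsilon> \<theta>) A + measure (gauss_seq \<epsilon> \<theta>') B"
proof -
  let ?N = "\<lambda>\<theta> i. density lborel (\<lambda>x. ennreal (normal_density (\<theta> i) \<epsilon> x))"
  define R where "R = PiM ({1..} - {m}) (?N \<theta>)"
  \<comment> \<open>A point of \<open>J\<close> is within \<open>\<epsilon> / 2\<close> of
    \<open>s\<close>, hence within \<open>\<epsilon>\<close> of both means; so \<open>c\<close>
    bounds both densities from below on \<open>J\<close>.\<close>
  define J where "J = {s - \<epsilon> / 2..s + \<epsilon> / 2}"
  define c where "c = exp (- 1 / 2) / (sqrt (2 * pi) * \<epsilon>)"
  define K where "K A x = emeasure R {X \<in> space R. X(m := x) \<in> A}" for A x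
  have c: "c \<ge> 0" using assms(1) by (simp add: c_def)
  have prob: "prob_space (?N \<theta> i)" for \<theta> i
    using prob_space_normal_density[OF assms(1)] by simp
  interpret R: prob_space R unfolding R_def by (intro prob_space_PiM prob)
  \<comment> \<open>The parameters agree off \<open>m\<close>, so the remaining coordinates have the
    same law \<open>R\<close> under both.\<close>
  have R': "R = PiM ({1..} - {m}) (?N \<theta>')"
    unfolding R_def by (intro PiM_cong) (auto simp: agree)
  \<comment> \<open>Stated for a generic event \<open>C\<close> and parameter \<open>\<eta>\<close>,
    so that \<open>lower\<close> serves both \<open>A\<close> with \<open>\<theta>\<close> and
    \<open>B\<close> with \<open>\<theta>'\<close>.\<close>
  have K_meas: "K C \<in> borel_measurable borel"
    and K_sets: "{X \<in> space R. X(m := x) \<in> C} \<in> sets R"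
    and lower: "\<bar>\<eta> m - s\<bar> \<le> \<epsilon> / 2 \<Longrightarrow> R = PiM ({1..} - {m}) (?N \<eta>) \<Longrightarrow>
      (\<integral>\<^sup>+x. ennreal c * indicator J x * K C x \<partial>lborel) \<le> emeasure (gauss_seq \<epsilon> \<eta>) C"
    if C: "C \<in> sets (\<Pi>\<^sub>M i\<in>{1..}. borel)" for C \<eta> x
  proof -
    have C': "C \<in> sets (PiM {1..} (?N \<eta>))" for \<eta>
      using C sets_gauss_seq[of \<epsilon> \<eta>] unfolding gauss_seq_def by simp
    have m: "m \<in> {1..}" using assms(2) by simp
    note coord\<theta> = emeasure_PiM_coordinate[where M = "?N \<theta>", OF prob[of \<theta>] m C'[of \<theta>]]
    note coord\<eta> = emeasure_PiM_coordinate[where M = "?N \<eta>", OF prob[of \<eta>] m C'[of \<eta>]]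
    show meas: "K C \<in> borel_measurable borel"
      using coord\<theta>(2) unfolding K_def R_def by simp
    show "{X \<in> space R. X(m := x) \<in> C} \<in> sets R"
      using coord\<theta>(3)[of x] unfolding R_def by simp
    assume \<eta>: "\<bar>\<eta> m - s\<bar> \<le> \<epsilon> / 2" and R\<eta>: "R = PiM ({1..} - {m}) (?N \<eta>)"
    have "(\<integral>\<^sup>+x. ennreal c * indicator J x * K C x \<partial>lborel)
      \<le> (\<integral>\<^sup>+x. ennreal (normal_density (\<eta> m) \<epsilon> x) * K C x \<partial>lborel)"
    proof (intro nn_integral_mono mult_right_mono)
      fix x
      have "c \<le> normal_density (\<eta> m) \<epsilon> x" if "x \<in> J"
        unfolding c_def
      proof (rule normal_density_lower_bound[OF assms(1)])
        show "\<bar>x - \<eta> m\<bar> \<le> \<epsilon>" using that \<eta> unfolding J_def atLeastAtMost_iff by linarith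
      qed
      then show "ennreal c * indicator J x \<le> ennreal (normal_density (\<eta> m) \<epsilon> x)"
        by (auto simp: indicator_def intro: ennreal_leI)
    qed simp
    also have "\<dots> = (\<integral>\<^sup>+x. K C x \<partial>?N \<eta> m)"
      using meas by (subst nn_integral_density) auto
    also have "\<dots> = emeasure (gauss_seq \<epsilon> \<eta>) C"
      using coord\<eta>(1) unfolding gauss_seq_def K_def R\<eta> by simp
    finally show "(\<integral>\<^sup>+x. ennreal c * indicator J x * K C x \<partial>lborel)
      \<le> emeasure (gauss_seq \<epsilon> \<eta>) C" .
  qed
  \<comment> \<open>For each fixed \<open>x\<close> the sections of \<open>A\<close> and
    \<open>B\<close> cover the whole space of \<open>R\<close>, a probability space.\<close>
  have K_cover: "1 \<le> K A x + K B x" for x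
  proof -
    have "X(m := x) \<in> A \<union> B" if "X \<in> space R" for X
    proof -
      have "X(m := x) \<in> space (\<Pi>\<^sub>M i\<in>{1..}. borel)"
        using that assms(2) unfolding R_def by (auto simp: space_PiM PiE_def extensional_def)
      then show ?thesis using cover by auto
    qed
    then have "emeasure R (space R) \<le>
        emeasure R ({X \<in> space R. X(m := x) \<in> A} \<union> {X \<in> space R. X(m := x) \<in> B})"
      using K_sets[OF A] K_sets[OF B] by (intro emeasure_mono) auto
    also have "\<dots> \<le> K A x + K B x"
      unfolding K_def by (intro emeasure_subadditive K_sets A B)
    finally show ?thesis by (simp add: R.emeasure_space_1)
  qed
  have J: "J \<in> sets borel" "emeasure lborel J = ennreal \<epsilon>"
    using assms(1) by (auto simp: J_def)
  note [measurable] = K_meas[OF A] K_meas[OF B] J(1)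
  \<comment> \<open>The total mass of the common component: the length \<open>\<epsilon>\<close> of
    \<open>J\<close> cancels the \<open>\<epsilon>\<close> in the denominator of \<open>c\<close>,
    so the final bound is free of \<open>\<epsilon>\<close>.\<close>
  have "ennreal (c * \<epsilon>) = (\<integral>\<^sup>+x. ennreal c * indicator J x \<partial>lborel)"
    using c assms(1) J by (simp add: nn_integral_cmult_indicator ennreal_mult)
  also have "\<dots> \<le> (\<integral>\<^sup>+x. ennreal c * indicator J x * K A x
      + ennreal c * indicator J x * K B x \<partial>lborel)"
  proof (rule nn_integral_mono)
    fix x
    show "ennreal c * indicator J x
      \<le> ennreal c * indicator J x * K A x + ennreal c * indicator J x * K B x"
      using mult_left_mono[OF K_cover[of x], of "ennreal c * indicator J x"]
      by (simp add: distrib_left)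
  qed
  also have "\<dots> = (\<integral>\<^sup>+x. ennreal c * indicator J x * K A x \<partial>lborel)
      + (\<integral>\<^sup>+x. ennreal c * indicator J x * K B x \<partial>lborel)"
    by (intro nn_integral_add) auto
  also have "\<dots> \<le> emeasure (gauss_seq \<epsilon> \<theta>) A + emeasure (gauss_seq \<epsilon> \<theta>') B"
    by (intro add_mono lower A B near R_def R')
  also have "\<dots> = ennreal (measure (gauss_seq \<epsilon> \<theta>) A + measure (gauss_seq \<epsilon> \<theta>') B)"
  proof -
    interpret P: prob_space "gauss_seq \<epsilon> \<theta>" by (rule prob_space_gauss_seq[OF assms(1)])
    interpret P': prob_space "gauss_seq \<epsilon> \<theta>'" by (rule prob_space_gauss_seq[OF assms(1)])
    show ?thesis by (simp add: P.emeasure_eq_measure P'.emeasure_eq_measure)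
  qed
  finally have "c * \<epsilon> \<le> measure (gauss_seq \<epsilon> \<theta>) A + measure (gauss_seq \<epsilon> \<theta>') B"
    by (subst (asm) ennreal_le_iff) (auto intro: add_nonneg_nonneg)
  then show ?thesis using assms(1) by (simp add: c_def)
qed

text \<open>Restricting the function to \<open>{1..}\<close> leaves it \<open>undefined\<close> at
  index 0, as \<open>ell2\<close> demands through \<open>extensional\<close>.\<close>

definition spike :: "nat \<Rightarrow> real \<Rightarrow> nat \<Rightarrow> real" where
  "spike m a = (\<lambda>i\<in>{1..}. if i = m then a else 0)"

lemma spike_in_ell2: "spike m a \<in> ell2"
proof -
  have "(\<lambda>i. (spike m a i)\<^sup>2) summable_on {1..} \<longleftrightarrow> (\<lambda>i. (spike m a i)\<^sup>2) summable_on ({1..} \<inter> {m})"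
    by (intro summable_on_cong_neutral) (auto simp: spike_def)
  then show ?thesis
    by (auto simp: ell2_def spike_def)
qed

lemma risk_proxy_spike:
  assumes "m \<ge> 1"
  shows "risk_proxy \<epsilon> \<tau> (spike m a) k = (if k < m then a\<^sup>2 else 0) + \<tau> * real k * \<epsilon>\<^sup>2"
proof -
  have "(\<Sum>\<^sub>\<infinity>i\<in>{k<..}. (spike m a i)\<^sup>2) = (\<Sum>\<^sub>\<infinity>i\<in>{k<..} \<inter> {m}. (spike m a i)\<^sup>2)"
    by (intro infsum_cong_neutral) (auto simp: spike_def)
  also have "\<dots> = (if k < m then a\<^sup>2 else 0)"
    using assms by (auto simp: spike_def)
  finally show ?thesis by (simp add: risk_proxy_def)
qed

text \<open>The risk proxy increases strictly on \<open>k < m\<close> and on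
  \<open>k \<ge> m\<close>, so only 1 and \<open>m\<close> can be minimizers. The strict
  inequalities on \<open>a\<^sup>2\<close> rule out a tie between them, so the result holds for
  every choice of minimizers \<open>d\<close>.\<close>

lemma effective_dimension_spike:
  assumes "\<epsilon> > 0" and "\<tau> > 0" and "m \<ge> 1" and d: "effective_dimension \<epsilon> d"
  shows "a\<^sup>2 > \<tau> * (real m - 1) * \<epsilon>\<^sup>2 \<Longrightarrow> d \<tau> (spike m a) = m"
    and "a\<^sup>2 < \<tau> * (real m - 1) * \<epsilon>\<^sup>2 \<Longrightarrow> d \<tau> (spike m a) = 1"
proof -
  define k where "k = d \<tau> (spike m a)"
  have "is_arg_min (risk_proxy \<epsilon> \<tau> (spike m a)) (\<lambda>k. k \<ge> 1) k"
    using d assms(2) spike_in_ell2 unfolding effective_dimension_def k_def by blast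
  then have k: "k \<ge> 1"
    and min: "\<And>j. j \<ge> 1 \<Longrightarrow> risk_proxy \<epsilon> \<tau> (spike m a) k \<le> risk_proxy \<epsilon> \<tau> (spike m a) j"
    unfolding is_arg_min_linorder by auto
  define t where "t = \<tau> * \<epsilon>\<^sup>2"
  have t: "t > 0" using assms by (simp add: t_def)
  have r: "risk_proxy \<epsilon> \<tau> (spike m a) j = (if j < m then a\<^sup>2 else 0) + t * real j" for j
    using risk_proxy_spike[OF assms(3)] by (simp add: t_def mult_ac)
  have thr: "\<tau> * (real m - 1) * \<epsilon>\<^sup>2 = t * (real m - 1)"
    by (simp add: t_def)
  have mono: "t * real i < t * real j" if "i < j" for i j :: nat
    using that t by simp
  have m1: "t \<le> t * real j" if "j \<ge> 1" for j :: nat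
    using that t by simp
  have min1: "(if k < m then a\<^sup>2 else 0) + t * real k \<le> (if 1 < m then a\<^sup>2 else 0) + t"
    using min[of 1] unfolding r by simp
  have minm: "(if k < m then a\<^sup>2 else 0) + t * real k \<le> t * real m"
    using min[of m] assms(3) unfolding r by simp
  show "d \<tau> (spike m a) = m" if "a\<^sup>2 > \<tau> * (real m - 1) * \<epsilon>\<^sup>2"
  proof -
    have "t * real m < a\<^sup>2 + t" using that unfolding thr by (simp add: algebra_simps)
    \<comment> \<open>If \<open>k < m\<close>, the risk is at least \<open>a\<^sup>2 + t\<close>,
      which exceeds the risk at \<open>m\<close>; if \<open>k > m\<close>, the linear term alone is
      too large.\<close>
    then have "k = m"
      using minm m1[OF k] mono[of m k] by (cases k m rule: linorder_cases) auto
    then show ?thesis by (simp add: k_def)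
  qed
  show "d \<tau> (spike m a) = 1" if "a\<^sup>2 < \<tau> * (real m - 1) * \<epsilon>\<^sup>2"
  proof -
    have lt: "a\<^sup>2 + t < t * real m" using that unfolding thr by (simp add: algebra_simps)
    \<comment> \<open>This selects the branch \<open>a\<^sup>2\<close> on the right of
      \<open>min1\<close>; for \<open>m = 1\<close> the assumption would force a negative
      square.\<close>
    have "m > 1"
    proof (rule ccontr)
      assume "\<not> m > 1"
      then have "m = 1" using assms(3) by simp
      with lt show False by (simp add: not_less[symmetric])
    qed
    moreover have "k < m"
    proof (rule ccontr)
      assume "\<not> k < m"
      then have "t * real m \<le> t * real k" using t by simp
      with min1 lt \<open>m > 1\<close> \<open>\<not> k < m\<close> show False by simp
    qed
    ultimately have "t * real k \<le> t" using min1 by simp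
    then have "k \<le> 1" using mono[of 1 k] by (cases "k \<le> 1") auto
    then show ?thesis using k by (simp add: k_def)
  qed
qed

theorem corollary2:
  fixes \<epsilon> :: real and d :: "real \<Rightarrow> (nat \<Rightarrow> real) \<Rightarrow> nat"
  assumes "\<epsilon> > 0" and "effective_dimension \<epsilon> d"
  shows "\<exists>\<delta>::real. \<delta> > 0 \<and>
    (\<forall>d'\<in>estimators. \<forall>\<tau>::real. \<forall>L::nat. \<tau> > 0 \<longrightarrow> L \<ge> 1 \<longrightarrow>
      (SUP \<theta>\<in>ell2. measure (gauss_seq \<epsilon> \<theta>)
         {x \<in> space (gauss_seq \<epsilon> \<theta>). \<bar>d' x - real (d \<tau> \<theta>)\<bar> \<ge> real L}) \<ge> \<delta>)"
proof (intro exI conjI ballI allI impI)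
  \<comment> \<open>Half of the common mass: of two probabilities with at least that sum, the larger
    is at least half of it.\<close>
  let ?\<delta> = "exp (- 1 / 2) / sqrt (2 * pi) / 2 :: real"
  show "?\<delta> > 0" by simp
  fix d' and \<tau> :: real and L :: nat
  assume d': "d' \<in> estimators" and "\<tau> > 0" and "L \<ge> 1"
  define m where "m = 2 * L + 1"
  \<comment> \<open>The amplitude at which 1 and \<open>m\<close> tie as minimizers; see
    \<open>s2\<close>.\<close>
  define s where "s = sqrt (2 * real L * \<tau>) * \<epsilon>"
  \<comment> \<open>The bound \<open>\<epsilon> / 2\<close> keeps both amplitudes in the range of
    the overlap lemma; \<open>s / 2\<close> keeps \<open>s - h\<close> positive, so that squaring
    preserves the order.\<close>
  define h where "h = min (\<epsilon> / 2) (s / 2)"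
  let ?S = "\<Pi>\<^sub>M i\<in>{1::nat..}. (borel :: real measure)"
  let ?A = "\<lambda>\<theta>. {x \<in> space ?S. \<bar>d' x - real (d \<tau> \<theta>)\<bar> \<ge> real L}"
  let ?P = "\<lambda>\<theta>. measure (gauss_seq \<epsilon> \<theta>) (?A \<theta>)"
  let ?\<theta> = "spike m (s + h)" and ?\<theta>' = "spike m (s - h)"
  have "s > 0" using assms(1) \<open>\<tau> > 0\<close> \<open>L \<ge> 1\<close> by (simp add: s_def)
  then have h: "h > 0" "h < s" "h \<le> \<epsilon> / 2" using assms(1) by (auto simp: h_def)
  have m: "m \<ge> 1" by (simp add: m_def)
  have s2: "s\<^sup>2 = \<tau> * (real m - 1) * \<epsilon>\<^sup>2"
    using \<open>\<tau> > 0\<close> by (simp add: s_def m_def power_mult_distrib)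
  have "s\<^sup>2 < (s + h)\<^sup>2" "(s - h)\<^sup>2 < s\<^sup>2"
    using h by (auto intro!: power_strict_mono)
  then have dim: "d \<tau> ?\<theta> = m" "d \<tau> ?\<theta>' = 1"
    using effective_dimension_spike[OF assms(1) \<open>\<tau> > 0\<close> m assms(2)] unfolding s2 by auto
  \<comment> \<open>The sample space in the goal is written with \<open>\<theta>\<close>; passing to
    \<open>?S\<close> puts all error events in one space.\<close>
  have space: "space (gauss_seq \<epsilon> \<theta>) = space ?S" for \<theta>
    using sets_gauss_seq by (rule sets_eq_imp_space_eq)
  have [measurable]: "d' \<in> borel_measurable ?S"
    using d' by (simp add: estimators_def)
  have A: "?A \<theta> \<in> sets ?S" for \<theta> by measurable
  have "2 * ?\<delta> \<le> ?P ?\<theta> + ?P ?\<theta>'"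
  proof -
    \<comment> \<open>The dimensions \<open>m\<close> and 1 are \<open>2 * L\<close> apart, so no
      real number is at distance less than \<open>L\<close> from both.\<close>
    have "space ?S \<subseteq> ?A ?\<theta> \<union> ?A ?\<theta>'"
      unfolding dim by (auto simp: m_def)
    moreover have "\<bar>?\<theta> m - s\<bar> \<le> \<epsilon> / 2" "\<bar>?\<theta>' m - s\<bar> \<le> \<epsilon> / 2"
      using h m by (auto simp: spike_def)
    ultimately show ?thesis
      using gauss_seq_overlap[OF assms(1) m, of ?\<theta> ?\<theta>' s "?A ?\<theta>" "?A ?\<theta>'"] A
      by (auto simp: spike_def)
  qed
  moreover have "?P \<theta> \<le> (SUP \<theta>\<in>ell2. ?P \<theta>)" if "\<theta> \<in> ell2" for \<theta>
  proof (rule cSUP_upper[OF that])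
    \<comment> \<open>A real supremum is an upper bound only for a set bounded above; here the
      values are probabilities.\<close>
    show "bdd_above (?P ` ell2)"
      using prob_space.prob_le_1[OF prob_space_gauss_seq[OF assms(1)]]
      by (auto intro!: bdd_aboveI[of _ 1])
  qed
  note this[OF spike_in_ell2[of m "s + h"]] this[OF spike_in_ell2[of m "s - h"]]
  ultimately have "?\<delta> \<le> (SUP \<theta>\<in>ell2. ?P \<theta>)"
    by linarith
  then show "?\<delta> \<le> (SUP \<theta>\<in>ell2. measure (gauss_seq \<epsilon> \<theta>)
         {x \<in> space (gauss_seq \<epsilon> \<theta>). \<bar>d' x - real (d \<tau> \<theta>)\<bar> \<ge> real L})"
    unfolding space .
qed

end
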